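(* Let $L_{<t}:\mathbb{R}^d\to\mathbb{R}$ be the retained old-distribution loss and $L_t:\mathbb{R}^d\to\mathbb{R}$ the current-task loss, with $L_t$ differentiable at $R_{t-1}\in\mathbb{R}^d$. Let $R_{t-1}$ be a local minimizer of $L_{<t}$, and suppose $L_{<t}$ is twice differentiable around $R_{t-1}$ with Hessian $H_{<t}=\nabla^2 L_{<t}(R_{t-1})\succeq 0$. For $\eta>0$ consider the naive current-task update $$R_t^{\mathrm{naive}}=R_{t-1}-\eta g_t,\qquad g_t=\nabla L_t(R_{t-1}).$$ Then, for sufficiently small $\eta$, $$L_{<t}(R_t^{\mathrm{naive}})-L_{<t}(R_{t-1})=\frac{\eta^2}{2}\,g_t^\top H_{<t}\,g_t+o(\eta^2)\qquad(\eta\to 0^+).$$ Consequently, whenever $g_t$ has nonzero projection onto a positive-curvature direction of $H_{<t}$, naive adaptation increases the retained old-distribution loss, i.e. $L_{<t}(R_t^{\mathrm{naive}})>L_{<t}(R_{t-1})$ for all sufficiently small $\eta>0$.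
   Context: Task distributions $D_1,D_2,\ldots$ are encountered sequentially. For a capability state $R$ and a task instance $x$, $\ell(R;x)$ is the loss, and $L_i(R)=\mathbb{E}_{x\sim D_i}[\ell(R;x)]$ is the stage-$i$ loss. The retained old-distribution loss at stage $t$ is $L_{<t}(R)=\sum_{i<t}\alpha_i L_i(R)$ with weights $\alpha_i\ge 0$, $\sum_{i<t}\alpha_i=1$. In the local analysis the capability state is represented by a vector in $\mathbb{R}^d$ (a continuous local surrogate), and $L_{<t}$, $L_t$ are real-valued functions on it. No structure of these losses beyond the stated regularity and local-minimizer hypotheses is assumed. A positive-curvature direction of the symmetric positive semidefinite matrix $H_{<t}$ is an eigenvector $v$ of $H_{<t}$ with strictly positive eigenvalue. "$g_t$ has nonzero projection onto" it means $g_t^\top v\neq 0$. *)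

theory Defs
  imports "HOL-Analysis.Analysis" "HOL-Library.Landau_Symbols"
begin

(* Unspecified where f is not differentiable; all uses below are guarded by differentiability. *)
definition gradient :: "(real^'n \<Rightarrow> real) \<Rightarrow> real^'n \<Rightarrow> real^'n" where
  "gradient f x = (THE g. GDERIV f x :> g)"

(* Entry (i, j) is the j-th partial derivative of the i-th component of the gradient. *)
definition hessian :: "(real^'n \<Rightarrow> real) \<Rightarrow> real^'n \<Rightarrow> real^'n^'n" where
  "hessian f x = jacobian (gradient f) (at x)"

definition twice_differentiable_around :: "(real^'n \<Rightarrow> real) \<Rightarrow> real^'n \<Rightarrow> bool" where
  "twice_differentiable_around f x \<longleftrightarrow>
     (\<exists>U. open U \<and> x \<in> U \<and>
        (\<forall>y\<in>U. f differentiable (at y) \<and> gradient f differentiable (at y)))"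

definition local_minimizer :: "(real^'n \<Rightarrow> real) \<Rightarrow> real^'n \<Rightarrow> bool" where
  "local_minimizer f x \<longleftrightarrow> (\<forall>\<^sub>F y in nhds x. f x \<le> f y)"

definition positive_semidefinite :: "real^'n^'n \<Rightarrow> bool" where
  "positive_semidefinite A \<longleftrightarrow> transpose A = A \<and> (\<forall>x. 0 \<le> x \<bullet> (A *v x))"

definition positive_curvature_direction :: "real^'n^'n \<Rightarrow> real^'n \<Rightarrow> bool" where
  "positive_curvature_direction A v \<longleftrightarrow> v \<noteq> 0 \<and> (\<exists>c>0. A *v v = c *\<^sub>R v)"

definition naive_update :: "(real^'n \<Rightarrow> real) \<Rightarrow> real^'n \<Rightarrow> real \<Rightarrow> real^'n" where
  "naive_update L R \<eta> = R - \<eta> *\<^sub>R gradient L R"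

lemma gradient_eqI:
  assumes "GDERIV f x :> g"
  shows "gradient f x = g"
  unfolding gradient_def
proof (rule the_equality)
  show "GDERIV f x :> g" by (fact assms)
next
  fix g' assume "GDERIV f x :> g'"
  with assms have "(\<lambda>h. h \<bullet> g') = (\<lambda>h. h \<bullet> g)"
    unfolding gderiv_def using has_derivative_unique by blast
  then show "g' = g"
    by (metis vector_eq_ldot)
qed

lemma gradient_works:
  fixes f :: "real^'n \<Rightarrow> real"
  assumes "f differentiable (at x)"
  shows "GDERIV f x :> gradient f x"
proof -
  obtain f' where f': "(f has_derivative f') (at x)"
    using assms by (auto simp: differentiable_def)
  then have "linear f'"
    by (rule has_derivative_linear)
  then have "f' = (\<lambda>h. h \<bullet> adjoint f' 1)"
    by (simp add: fun_eq_iff adjoint_works)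
  with f' have "GDERIV f x :> adjoint f' 1"
    unfolding gderiv_def by simp
  then show ?thesis
    by (simp add: gradient_eqI)
qed

lemma hessian_works:
  assumes "gradient f differentiable (at x)"
  shows "(gradient f has_derivative (\<lambda>h. hessian f x *v h)) (at x)"
  using assms jacobian_works unfolding hessian_def by blast

end

theory Submission
  imports Defs
begin

text \<open>
  At a local minimizer the gradient of the old loss vanishes, so the second-order Taylor expansion with
  Peano remainder along the line through \<open>R\<close> with direction \<open>-g\<close> starts with the quadratic term.
  The Hessian is only assumed to exist as the derivative of the gradient at \<open>R\<close>, without continuity,
  and the Peano form needs no more. If \<open>H v = c v\<close> with \<open>c > 0\<close>, then positive semidefiniteness of \<open>H\<close>,
  tested on the component of \<open>g\<close> orthogonal to \<open>v\<close>, yields \<open>g \<bullet> H g \<ge> c (g \<bullet> v)\<^sup>2 / (v \<bullet> v) > 0\<close>.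
\<close>

text \<open>A single use of l'Hopital replaces division of the remainder by \<open>h\<^sup>2\<close>
  with \<open>(f' h - f' 0 - h * c) / (2 * h)\<close>, which tends to 0 because \<open>c\<close> is
  the derivative of \<open>f'\<close> at 0. A second use would need a limit of the second derivative
  at 0.\<close>

lemma taylor_peano_second_order:
  fixes f f' :: "real \<Rightarrow> real"
  assumes f: "\<forall>\<^sub>F y in nhds 0. (f has_real_derivative f' y) (at y)"
    and f': "(f' has_real_derivative c) (at 0)"
  shows "(\<lambda>h. f h - f 0 - f' 0 * h - h\<^sup>2 / 2 * c) \<in> o[at 0](\<lambda>h. h\<^sup>2)"
proof (rule smalloI_tendsto)
  have ev: "\<forall>\<^sub>F h in at 0. (f has_real_derivative f' h) (at h)"
    using f by (auto simp: eventually_at_filter elim: eventually_mono)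
  have "(f has_real_derivative f' 0) (at 0)"
    using f by (rule eventually_nhds_x_imp_x)
  then have "f \<midarrow>0\<rightarrow> f 0"
    using DERIV_isCont isCont_def by blast
  then have num: "(\<lambda>h. f h - f 0 - f' 0 * h - h\<^sup>2 / 2 * c) \<midarrow>0\<rightarrow> 0"
    by (auto intro!: tendsto_eq_intros)
  have "(\<lambda>h. (f' h - f' 0) / h) \<midarrow>0\<rightarrow> c"
    using f' by (simp add: has_field_derivative_iff)
  then have "(\<lambda>h. ((f' h - f' 0) / h - c) / 2) \<midarrow>0\<rightarrow> (c - c) / 2"
    by (intro tendsto_intros) simp_all
  then have "(\<lambda>h. ((f' h - f' 0) / h - c) / 2) \<midarrow>0\<rightarrow> 0"
    by simp
  \<comment> \<open>The ratio of derivatives is half the error of the difference quotient of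
    \<open>f'\<close>, as long as \<open>h\<close> is nonzero.\<close>
  moreover have "\<forall>\<^sub>F h in at 0. ((f' h - f' 0) / h - c) / 2 = (f' h - f' 0 - h * c) / (2 * h)"
    by (auto simp: eventually_at_filter field_simps)
  ultimately have quot: "(\<lambda>h. (f' h - f' 0 - h * c) / (2 * h)) \<midarrow>0\<rightarrow> 0"
    using tendsto_cong by fast
  show "(\<lambda>h. (f h - f 0 - f' 0 * h - h\<^sup>2 / 2 * c) / h\<^sup>2) \<midarrow>0\<rightarrow> 0"
  proof (rule lhopital[OF num _ _ _ _ _ quot])
    show "(\<lambda>h::real. h\<^sup>2) \<midarrow>0\<rightarrow> 0"
      by (auto intro!: tendsto_eq_intros)
    show "\<forall>\<^sub>F h in at 0. ((\<lambda>h. f h - f 0 - f' 0 * h - h\<^sup>2 / 2 * c) has_real_derivative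
        f' h - f' 0 - h * c) (at h)"
      using ev by eventually_elim (auto intro!: derivative_eq_intros)
    show "\<forall>\<^sub>F h in at 0. ((\<lambda>h::real. h\<^sup>2) has_real_derivative 2 * h) (at h)"
      by (auto intro!: always_eventually derivative_eq_intros)
  qed (auto simp: eventually_at_filter)
  show "\<forall>\<^sub>F h in at 0. (h::real)\<^sup>2 \<noteq> 0"
    by (auto simp: eventually_at_filter)
qed

lemma gradient_local_minimizer:
  fixes f :: "real^'n \<Rightarrow> real"
  assumes "local_minimizer f x" and "f differentiable (at x)"
  shows "gradient f x = 0"
proof -
  obtain S where S: "open S" "x \<in> S" "\<And>y. y \<in> S \<Longrightarrow> f x \<le> f y"
    using assms(1) unfolding local_minimizer_def eventually_nhds by blast
  have "(f has_derivative (\<lambda>h. h \<bullet> gradient f x)) (at x)"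
    using gradient_works[OF assms(2)] by (simp add: gderiv_def)
  then have "(\<lambda>h. h \<bullet> gradient f x) = (\<lambda>h. 0)"
    using S by (intro differential_zero_maxmin[of x S f]) auto
  \<comment> \<open>Evaluating at \<open>h = gradient f x\<close> makes the squared norm of the
    gradient vanish.\<close>
  then show ?thesis
    by (metis inner_eq_zero_iff)
qed

text \<open>Restricting \<open>f\<close> to the line \<open>p\<close> reduces the claim to one real
  variable. The chain rule gives the first derivative at all \<open>h\<close> near 0, where
  \<open>p h\<close> stays in \<open>U\<close>, and the second derivative at 0 from the Hessian at
  \<open>x\<close>.\<close>

lemma line_expansion:
  fixes f :: "real^'n \<Rightarrow> real"
  assumes "twice_differentiable_around f x"
  shows "(\<lambda>h. f (x + h *\<^sub>R u) - f x - (u \<bullet> gradient f x) * h - h\<^sup>2 / 2 * (u \<bullet> (hessian f x *v u)))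
           \<in> o[at 0](\<lambda>h. h\<^sup>2)"
proof -
  obtain U where U: "open U" "x \<in> U" "\<And>y. y \<in> U \<Longrightarrow> f differentiable (at y)"
      "\<And>y. y \<in> U \<Longrightarrow> gradient f differentiable (at y)"
    using assms unfolding twice_differentiable_around_def by blast
  define p where "p h = x + h *\<^sub>R u" for h :: real
  have p: "(p has_derivative (\<lambda>k. k *\<^sub>R u)) (at h)" for h
    unfolding p_def by (auto intro!: derivative_eq_intros)
  have "\<forall>\<^sub>F h in nhds 0. h \<in> p -` U"
  proof (rule eventually_nhds_in_open)
    show "open (p -` U)"
      unfolding p_def using U(1) by (intro open_vimage continuous_intros) auto
  qed (use U(2) in \<open>simp add: p_def\<close>)
  then have "\<forall>\<^sub>F h in nhds 0. ((\<lambda>h. f (p h)) has_real_derivative u \<bullet> gradient f (p h)) (at h)"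
  proof eventually_elim
    case (elim h)
    then have "(f has_derivative (\<lambda>k. k \<bullet> gradient f (p h))) (at (p h))"
      using gradient_works[OF U(3)] by (simp add: gderiv_def)
    from has_derivative_compose[OF p this] show ?case
      by (simp add: has_field_derivative_def mult_commute_abs)
  qed
  moreover have "((\<lambda>h. u \<bullet> gradient f (p h)) has_real_derivative u \<bullet> (hessian f x *v u)) (at 0)"
  proof -
    have "(gradient f has_derivative (\<lambda>k. hessian f x *v k)) (at (p 0))"
      using hessian_works[OF U(4)[OF U(2)]] by (simp add: p_def)
    from has_derivative_inner_right[OF has_derivative_compose[OF p this], of u]
    show ?thesis
      by (simp add: has_field_derivative_def mult_commute_abs matrix_vector_mult_scaleR)
  qed
  ultimately show ?thesis
    using taylor_peano_second_order[of "\<lambda>h. f (p h)" "\<lambda>h. u \<bullet> gradient f (p h)"]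
    by (simp add: p_def)
qed

lemma quadratic_form_pos:
  fixes A :: "real^'n^'n"
  assumes A: "positive_semidefinite A" and v: "positive_curvature_direction A v" and "g \<bullet> v \<noteq> 0"
  shows "0 < g \<bullet> (A *v g)"
proof -
  obtain c where "v \<noteq> 0" "c > 0" and c: "A *v v = c *\<^sub>R v"
    using v unfolding positive_curvature_direction_def by blast
  \<comment> \<open>With this coefficient \<open>a *\<^sub>R v\<close> is the orthogonal projection
    of \<open>g\<close> onto \<open>v\<close>.\<close>
  define a where "a = (g \<bullet> v) / (v \<bullet> v)"
  have "transpose A = A"
    using A by (simp add: positive_semidefinite_def)
  \<comment> \<open>Symmetry moves \<open>A\<close> onto the eigenvector, so both cross terms below
    become \<open>- a * c * (g \<bullet> v)\<close>; the square term then cancels one of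
    them.\<close>
  then have "v \<bullet> (A *v g) = c * (g \<bullet> v)"
    by (metis c dot_lmul_matrix inner_commute inner_scaleR_right transpose_matrix_vector)
  then have "(g - a *\<^sub>R v) \<bullet> (A *v (g - a *\<^sub>R v))
      = g \<bullet> (A *v g) - 2 * a * c * (g \<bullet> v) + a * c * (a * (v \<bullet> v))"
    by (simp add: matrix_vector_mult_diff_distrib matrix_vector_mult_scaleR c inner_diff_left
        inner_diff_right algebra_simps)
  also have "a * (v \<bullet> v) = g \<bullet> v"
    using \<open>v \<noteq> 0\<close> by (simp add: a_def)
  finally have "(g - a *\<^sub>R v) \<bullet> (A *v (g - a *\<^sub>R v)) = g \<bullet> (A *v g) - a * c * (g \<bullet> v)"
    by simp
  moreover have "0 \<le> (g - a *\<^sub>R v) \<bullet> (A *v (g - a *\<^sub>R v))"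
    using A by (simp add: positive_semidefinite_def)
  moreover have "0 < a * c * (g \<bullet> v)"
  proof -
    have "a * c * (g \<bullet> v) = c * (g \<bullet> v)\<^sup>2 / (v \<bullet> v)"
      by (simp add: a_def power2_eq_square)
    then show ?thesis
      using \<open>c > 0\<close> \<open>v \<noteq> 0\<close> \<open>g \<bullet> v \<noteq> 0\<close> by simp
  qed
  ultimately show ?thesis by linarith
qed

theorem proposition1:
  fixes L_old L_cur :: "real^'n \<Rightarrow> real" and R g :: "real^'n" and H :: "real^'n^'n"
  assumes "L_cur differentiable (at R)"
    and "local_minimizer L_old R"
    and "twice_differentiable_around L_old R"
    and "H = hessian L_old R"
    and "positive_semidefinite H"
    and "g = gradient L_cur R"
  shows "(\<lambda>\<eta>. L_old (naive_update L_cur R \<eta>) - L_old R - \<eta>\<^sup>2 / 2 * (g \<bullet> (H *v g)))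
           \<in> o[at_right 0](\<lambda>\<eta>. \<eta>\<^sup>2)
       \<and> (\<forall>v. positive_curvature_direction H v \<and> g \<bullet> v \<noteq> 0 \<longrightarrow>
            (\<forall>\<^sub>F \<eta> in at_right 0. L_old (naive_update L_cur R \<eta>) > L_old R))"
proof (intro conjI allI impI)
  have "L_old differentiable (at R)"
    using assms(3) unfolding twice_differentiable_around_def by blast
  then have "gradient L_old R = 0"
    using assms(2) by (intro gradient_local_minimizer)
  \<comment> \<open>The linear term is gone since the gradient vanishes, and the sign of the
    direction \<open>- g\<close> cancels in the quadratic form.\<close>
  then have "(\<lambda>\<eta>. L_old (naive_update L_cur R \<eta>) - L_old R - \<eta>\<^sup>2 / 2 * (g \<bullet> (H *v g)))
      \<in> o[at 0](\<lambda>\<eta>. \<eta>\<^sup>2)"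
    using line_expansion[OF assms(3), of "- g"]
    by (simp add: naive_update_def assms(4,6) vec.neg)
  then show expansion: "(\<lambda>\<eta>. L_old (naive_update L_cur R \<eta>) - L_old R - \<eta>\<^sup>2 / 2 * (g \<bullet> (H *v g)))
      \<in> o[at_right 0](\<lambda>\<eta>. \<eta>\<^sup>2)"
    by (rule landau_o.small.filter_mono[rotated]) (simp add: at_le)
  fix v assume "positive_curvature_direction H v \<and> g \<bullet> v \<noteq> 0"
  then have pos: "0 < g \<bullet> (H *v g)"
    using quadratic_form_pos[OF assms(5)] by blast
  \<comment> \<open>The factor 1/4 bounds the remainder by half of the quadratic term, so the
    increase is at least \<open>\<eta>\<^sup>2 * (g \<bullet> (H *v g)) / 4\<close>.\<close>
  then have "\<forall>\<^sub>F \<eta> in at_right 0.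
      norm (L_old (naive_update L_cur R \<eta>) - L_old R - \<eta>\<^sup>2 / 2 * (g \<bullet> (H *v g)))
        \<le> (g \<bullet> (H *v g)) / 4 * norm (\<eta>\<^sup>2)"
    by (intro landau_o.smallD[OF expansion]) simp
  moreover have "\<forall>\<^sub>F \<eta> in at_right (0::real). 0 < \<eta>"
    by (rule eventually_at_right_less)
  ultimately show "\<forall>\<^sub>F \<eta> in at_right 0. L_old (naive_update L_cur R \<eta>) > L_old R"
  proof eventually_elim
    case (elim \<eta>)
    have "0 < \<eta>\<^sup>2 * (g \<bullet> (H *v g))"
      using elim pos by simp
    moreover have "\<eta>\<^sup>2 / 2 * (g \<bullet> (H *v g)) - (L_old (naive_update L_cur R \<eta>) - L_old R)
        \<le> \<eta>\<^sup>2 * (g \<bullet> (H *v g)) / 4"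
      using elim(1) unfolding real_norm_def abs_le_iff by (simp add: mult.commute)
    ultimately show ?case
      by (simp add: field_simps)
  qed
qed

end
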